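(* For every real $\lambda>0$, the algorithm BlockPacking with parameter $\lambda$ (defined in the context) has consistency $1+2/\lambda$ and robustness $2\lambda+4$ for general uncertainty sets and identical machines. That is, for all positive integers $m,n$, every nonempty bounded uncertainty set $\mathcal U\subseteq\mathbb R_{\ge0}^n$ of job-size vectors and every predicted scenario $\hat p\in\mathcal U$, the schedule $\mathcal S$ returned by BlockPacking satisfies $$C_{\max}(\mathcal S,\hat p)\le\Big(1+\frac2\lambda\Big)\mathrm{OPT}(\hat p)\quad\text{and}\quad \sup_{p\in\mathcal U}C_{\max}(\mathcal S,p)\le(2\lambda+4)\,\mathrm{OPT}^{\mathrm{rob}}(\mathcal U).$$
   Context: There are $m$ identical machines and $n$ jobs; a scenario is a vector $p\in\mathbb R_{\ge0}^n$ of job sizes. A schedule is a partition $\mathcal S=(S_1,\dots,S_m)$ of $[n]$ (parts may be empty), and $C_{\max}(\mathcal S,p)=\max_{i\in[m]}\sum_{j\in S_i}p_j$. $\mathrm{OPT}(p)=\min_{\mathcal S}C_{\max}(\mathcal S,p)$ and $\mathrm{OPT}^{\mathrm{rob}}(\mathcal U)=\min_{\mathcal S}\sup_{p\in\mathcal U}C_{\max}(\mathcal S,p)$. For a set $B$ of jobs write $\hat p(B)=\sum_{j\in B}\hat p_j$. Algorithm BlockPacking, on input $\hat p$, $\mathcal U$ and $\lambda>0$: 1. Let $(\hat S_1,\dots,\hat S_m)$ be a schedule minimizing $C_{\max}(\cdot,\hat p)$, and $(T_1,\dots,T_m)$ a schedule minimizing $\sup_{p\in\mathcal U}C_{\max}(\cdot,p)$.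 2. Let $\hat H=\{j\in[n]:\hat p_j>\mathrm{OPT}(\hat p)/\lambda\}$. For each $i\in[m]$ let $H_i=\hat S_i\cap\hat H$ and $y_i=\hat p(\hat S_i\setminus\hat H)$. 3. (Blocks.) For each $i\in[m]$, let $R=T_i\setminus\hat H$, ordered arbitrarily. While $\hat p(R)>\mathrm{OPT}(\hat p)/(2\lambda)$, let $B$ be the shortest prefix of $R$ with $\hat p(B)>\mathrm{OPT}(\hat p)/(2\lambda)$, declare $B$ a non-tiny block, and replace $R$ by $R\setminus B$. When the loop ends, if $R\ne\varnothing$, declare $R$ a tiny block. (So each $i$ yields at most one tiny block.) 4. Assign the tiny blocks injectively to distinct machines; let $L_i$ be the set of jobs in the tiny block assigned to machine $i$ (empty if there is none). 5. (First-crossing assignment.) Order the non-tiny blocks arbitrarily as $B^1,\dots,B^N$ and set $t=1$. For $i=1,\dots,m$ in order: if $t>N$, stop; else if $\sum_{s=t}^N\hat p(B^s)\le y_i$, add $B^t,\dots,B^N$ to $L_i$, set $t=N+1$, and stop; else let $\ell\ge t$ be the smallest index with $\sum_{s=t}^{\ell}\hat p(B^s)>y_i$, add $B^t,\dots,B^\ell$ to $L_i$, and set $t=\ell+1$. 6. Return $(H_1\cup L_1,\dots,H_m\cup L_m)$. The minimizations are exact; no running-time restriction is imposed. *)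

theory Defs
  imports "HOL-Analysis.Analysis" "HOL-Library.Sublist"
begin

text \<open>The jobs are the elements of the finite index type \<open>'n\<close> (so there are \<open>CARD('n)\<close> of them)
  and a scenario is a vector in \<open>real ^ 'n\<close>.  The machines are \<open>1, \<dots>, m\<close>.\<close>

definition load :: "real ^ 'n \<Rightarrow> 'n::finite set \<Rightarrow> real"
  where "load p A = (\<Sum>j\<in>A. p $ j)"

text \<open>Parts of a schedule may be empty.  A schedule is \<open>undefined\<close> outside \<open>{1..m}\<close>, so that
  the set of schedules is finite.\<close>

definition schedules :: "nat \<Rightarrow> (nat \<Rightarrow> 'n::finite set) set"
  where "schedules m =
    {S \<in> extensional {1..m}. disjoint_family_on S {1..m} \<and> (\<Union>i\<in>{1..m}. S i) = UNIV}"

definition cmax :: "nat \<Rightarrow> (nat \<Rightarrow> 'n::finite set) \<Rightarrow> real ^ 'n \<Rightarrow> real"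
  where "cmax m S p = (MAX i\<in>{1..m}. load p (S i))"

definition robust_cmax :: "nat \<Rightarrow> (nat \<Rightarrow> 'n::finite set) \<Rightarrow> (real ^ 'n) set \<Rightarrow> real"
  where "robust_cmax m S U = (SUP p\<in>U. cmax m S p)"

definition opt :: "nat \<Rightarrow> real ^ 'n::finite \<Rightarrow> real"
  where "opt m p = (MIN S\<in>schedules m. cmax m S p)"

definition opt_rob :: "nat \<Rightarrow> (real ^ 'n::finite) set \<Rightarrow> real"
  where "opt_rob m U = (MIN S\<in>schedules m. robust_cmax m S U)"

text \<open>\<open>cut_blocks p \<theta> R Bs Q\<close>: the loop that, while the load of the ordered list \<open>R\<close> exceeds
  \<open>\<theta>\<close>, removes its shortest prefix of load more than \<open>\<theta>\<close>, removes the blocks \<open>Bs\<close> and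
  ends with the remainder \<open>Q\<close>.\<close>

inductive cut_blocks ::
    "real ^ 'n \<Rightarrow> real \<Rightarrow> 'n::finite list \<Rightarrow> 'n list list \<Rightarrow> 'n list \<Rightarrow> bool"
  for p :: "real ^ 'n" and \<theta> :: real
where
  finish: "\<not> load p (set R) > \<theta> \<Longrightarrow> cut_blocks p \<theta> R [] R"
| cut: "load p (set (B @ R)) > \<theta> \<Longrightarrow> load p (set B) > \<theta> \<Longrightarrow>
    (\<forall>B'. strict_prefix B' B \<longrightarrow> \<not> load p (set B') > \<theta>) \<Longrightarrow>
    cut_blocks p \<theta> R Bs Q \<Longrightarrow> cut_blocks p \<theta> (B @ R) (B # Bs) Q"

text \<open>\<open>crossing p y N B i\<close> is the value of the index \<open>t\<close> in the first-crossing assignment of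
  \<open>B 1, \<dots>, B N\<close> once machines \<open>1, \<dots>, i\<close> have been processed, so machine \<open>i\<close> receives the
  blocks with indices in \<open>{crossing p y N B (i - 1)..<crossing p y N B i}\<close>.  The early stop is
  rendered by leaving \<open>t > N\<close> unchanged.\<close>

primrec crossing ::
    "real ^ 'n \<Rightarrow> (nat \<Rightarrow> real) \<Rightarrow> nat \<Rightarrow> (nat \<Rightarrow> 'n::finite set) \<Rightarrow> nat \<Rightarrow> nat"
where
  "crossing p y N B 0 = 1"
| "crossing p y N B (Suc i) =
    (let t = crossing p y N B i in
      if t > N then t
      else if (\<Sum>s=t..N. load p (B s)) \<le> y (Suc i) then N + 1
      else (LEAST l. l \<ge> t \<and> (\<Sum>s=t..l. load p (B s)) > y (Suc i)) + 1)"

text \<open>The algorithm leaves several choices open (optimal schedules, orderings, assignment of the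
  tiny blocks); \<open>block_packing m lam U phat S\<close> says that \<open>S\<close> is returned for some resolution of
  them.  Here \<open>R i\<close> is the chosen ordering of \<open>T i - Hh\<close>, \<open>Bs i\<close> and \<open>Q i\<close> are its non-tiny
  blocks and its remainder (a tiny block unless empty), \<open>\<sigma>\<close> assigns the tiny blocks to machines,
  and \<open>B\<close> enumerates the non-tiny blocks, which are nonempty and pairwise disjoint, hence distinct
  as sets.\<close>

definition block_packing ::
    "nat \<Rightarrow> real \<Rightarrow> (real ^ 'n) set \<Rightarrow> real ^ 'n \<Rightarrow> (nat \<Rightarrow> 'n::finite set) \<Rightarrow> bool"
where
  "block_packing m lam U phat S \<longleftrightarrow>
    (\<exists>Sh T R Bs Q \<sigma> N B.
      is_arg_min (\<lambda>S. cmax m S phat) (\<lambda>S. S \<in> schedules m) Sh \<and>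
      is_arg_min (\<lambda>S. robust_cmax m S U) (\<lambda>S. S \<in> schedules m) T \<and>
      (let Hh = {j. phat $ j > opt m phat / lam};
           H = (\<lambda>i. Sh i \<inter> Hh);
           y = (\<lambda>i. load phat (Sh i - Hh));
           tiny = {i\<in>{1..m}. Q i \<noteq> []};
           t = crossing phat y N B;
           L = (\<lambda>i. (\<Union>k\<in>{k\<in>tiny. \<sigma> k = i}. set (Q k)) \<union> (\<Union>s\<in>{t (i - 1)..<t i}. B s))
       in (\<forall>i\<in>{1..m}. distinct (R i) \<and> set (R i) = T i - Hh \<and>
             cut_blocks phat (opt m phat / (2 * lam)) (R i) (Bs i) (Q i)) \<and>
          inj_on \<sigma> tiny \<and> \<sigma> ` tiny \<subseteq> {1..m} \<and>
          bij_betw B {1..N} (\<Union>i\<in>{1..m}. set ` set (Bs i)) \<and>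
          S = (\<lambda>i\<in>{1..m}. H i \<union> L i)))"

end

theory Submission imports Defs
begin

text \<open>Write \<open>\<theta> = opt / (2 * lam)\<close>.  A non-tiny block consists of jobs of size at most \<open>2 * \<theta>\<close>, so
  minimality of the prefix bounds its predicted load by \<open>3 * \<theta>\<close>.  Compared with the optimal schedule
  for \<open>phat\<close>, machine \<open>i\<close> thus gains at most \<open>\<theta>\<close> from its tiny block and \<open>3 * \<theta>\<close> from the block
  crossing \<open>y i\<close>, together \<open>2 * opt / lam\<close>.  For robustness, every heavy job and every block is a
  subset of some \<open>T k\<close> and so costs at most \<open>opt_rob\<close> in any scenario.  With \<open>h\<close> heavy jobs and \<open>b\<close>
  non-tiny blocks on a machine, \<open>2 * h * \<theta> + (b - 1) * \<theta> \<le> opt\<close> gives \<open>h + b + 1 \<le> 2 * lam + 2\<close>.\<close>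

section \<open>Loads of sets of jobs\<close>

lemma load_nonneg:
  assumes "\<And>j. p $ j \<ge> 0"
  shows "load p A \<ge> 0"
  unfolding load_def by (intro sum_nonneg assms)

lemma load_mono:
  assumes "\<And>j. p $ j \<ge> 0" "A \<subseteq> B"
  shows "load p A \<le> load p B"
  unfolding load_def by (intro sum_mono2) (use assms in auto)

lemma load_Un_le:
  assumes "\<And>j. p $ j \<ge> 0"
  shows "load p (A \<union> B) \<le> load p A + load p B"
proof -
  have "load p (A \<union> B) = load p A + load p (B - A)"
    using sum.union_disjoint[of A "B - A" "\<lambda>j. p $ j"] by (simp add: load_def)
  then show ?thesis using load_mono[OF assms, of "B - A" B] by auto
qed

lemma load_UN_le:
  assumes "\<And>j. p $ j \<ge> 0" "finite I"
  shows "load p (\<Union>i\<in>I. A i) \<le> (\<Sum>i\<in>I. load p (A i))"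
  using assms(2)
proof (induction I)
  case empty
  then show ?case by (simp add: load_def)
next
  case (insert i I)
  then show ?case using load_Un_le[OF assms(1), of "A i" "\<Union>i\<in>I. A i"] by simp
qed

lemma load_UN_disjoint:
  assumes "finite I" "disjoint_family_on A I"
  shows "load p (\<Union>i\<in>I. A i) = (\<Sum>i\<in>I. load p (A i))"
  unfolding load_def
  by (intro sum.UNION_disjoint) (use assms in \<open>auto simp: disjoint_family_on_def\<close>)

lemma load_singleton: "load p {j} = p $ j"
  by (simp add: load_def)

section \<open>Schedules and their optimal values\<close>

lemma finite_schedules: "finite (schedules m :: (nat \<Rightarrow> 'n::finite set) set)"
proof (rule finite_subset)
  show "schedules m \<subseteq> (PiE {1..m} (\<lambda>_. UNIV) :: (nat \<Rightarrow> 'n set) set)"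
    unfolding schedules_def PiE_def by blast
qed (intro finite_PiE, auto)

lemma schedules_cover: "S \<in> schedules m \<Longrightarrow> \<exists>i\<in>{1..m}. x \<in> S i"
  unfolding schedules_def by blast

lemma schedules_unique:
  "S \<in> schedules m \<Longrightarrow> i \<in> {1..m} \<Longrightarrow> k \<in> {1..m} \<Longrightarrow> x \<in> S i \<Longrightarrow> x \<in> S k \<Longrightarrow> i = k"
  unfolding schedules_def disjoint_family_on_def by blast

lemma schedules_nonempty:
  assumes "m \<ge> 1"
  shows "(schedules m :: (nat \<Rightarrow> 'n::finite set) set) \<noteq> {}"
proof -
  have "(\<lambda>i\<in>{1..m}. if i = 1 then UNIV else {}) \<in> (schedules m :: (nat \<Rightarrow> 'n set) set)"
    using assms by (auto simp: schedules_def disjoint_family_on_def)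
  then show ?thesis by blast
qed

text \<open>Since \<open>schedules m\<close> is finite, any minimizer attains the
  \<open>Min\<close>. This ties the schedules chosen by the algorithm to \<open>opt\<close> and
  \<open>opt_rob\<close>.\<close>

lemma is_arg_min_schedules_eq_Min:
  assumes "is_arg_min f (\<lambda>S. S \<in> schedules m) S"
  shows "S \<in> schedules m" "(MIN S\<in>schedules m. f S) = (f S :: real)"
  using assms
  by (auto simp: is_arg_min_def not_less finite_schedules intro!: Min_eqI)

lemma ex_is_arg_min_schedules:
  fixes f :: "(nat \<Rightarrow> 'n::finite set) \<Rightarrow> real"
  assumes "m \<ge> 1"
  shows "\<exists>S. is_arg_min f (\<lambda>S. S \<in> schedules m) S"
  using ex_is_arg_min_if_finite[OF finite_schedules schedules_nonempty[OF assms], of f] by simp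

lemma load_le_cmax: "i \<in> {1..m} \<Longrightarrow> load p (S i) \<le> cmax m S p"
  unfolding cmax_def by (intro Max_ge) auto

lemma cmax_leI:
  assumes "m \<ge> 1" "\<And>i. i \<in> {1..m} \<Longrightarrow> load p (S i) \<le> c"
  shows "cmax m S p \<le> c"
  unfolding cmax_def using assms by (intro Max.boundedI) auto

text \<open>A real supremum is an upper bound only for a set bounded above. Here boundedness of
  \<open>U\<close> bounds every coordinate by a common \<open>b\<close>, hence every load by the sum
  of \<open>b\<close> over all jobs.\<close>

lemma cmax_le_robust_cmax:
  fixes U :: "(real ^ 'n::finite) set"
  assumes "bounded U" "\<And>p j. p \<in> U \<Longrightarrow> p $ j \<ge> 0" "p \<in> U" "m \<ge> 1"
  shows "cmax m S p \<le> robust_cmax m S U"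
proof -
  obtain b where b: "\<And>q. q \<in> U \<Longrightarrow> norm q \<le> b"
    using assms(1) by (auto simp: bounded_iff)
  have "cmax m S q \<le> (\<Sum>j\<in>(UNIV :: 'n set). b)" if "q \<in> U" for q
  proof (rule cmax_leI[OF assms(4)])
    fix i
    have "load q (S i) \<le> load q UNIV"
      using assms(2) that by (intro load_mono) auto
    also have "\<dots> \<le> (\<Sum>j\<in>(UNIV :: 'n set). b)"
      unfolding load_def
    proof (rule sum_mono)
      fix j
      show "q $ j \<le> b"
        using b[OF that] component_le_norm_cart[of q j] by linarith
    qed
    finally show "load q (S i) \<le> (\<Sum>j\<in>(UNIV :: 'n set). b)" .
  qed
  then show ?thesis
    unfolding robust_cmax_def
    by (intro cSUP_upper assms(3)) (auto intro!: bdd_aboveI2)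
qed

section \<open>Cutting an ordered list into blocks\<close>

lemma cut_blocks_concat: "cut_blocks p \<theta> R Bs Q \<Longrightarrow> concat Bs @ Q = R"
  by (induction rule: cut_blocks.induct) auto

lemma cut_blocks_remainder: "cut_blocks p \<theta> R Bs Q \<Longrightarrow> load p (set Q) \<le> \<theta>"
  by (induction rule: cut_blocks.induct) auto

lemma cut_blocks_gt: "cut_blocks p \<theta> R Bs Q \<Longrightarrow> A \<in> set Bs \<Longrightarrow> load p (set A) > \<theta>"
  by (induction rule: cut_blocks.induct) auto

text \<open>By minimality, a block without its last job has load at most \<open>\<theta>\<close>,
  and that last job adds at most \<open>c\<close>.\<close>

lemma cut_blocks_le:
  assumes "cut_blocks p \<theta> R Bs Q" "A \<in> set Bs" "\<theta> \<ge> 0"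
    "\<And>j. p $ j \<ge> 0" "\<And>j. j \<in> set R \<Longrightarrow> p $ j \<le> c"
  shows "load p (set A) \<le> \<theta> + c"
  using assms(1,2,5)
proof (induction rule: cut_blocks.induct)
  case (finish R)
  then show ?case by simp
next
  case (cut B R Bs Q)
  show ?case
  proof (cases "A = B")
    case True
    \<comment> \<open>The empty list has load 0, which does not exceed a nonnegative
      \<open>\<theta>\<close>.\<close>
    have ne: "B \<noteq> []" using cut.hyps(2) assms(3) by (auto simp: load_def)
    have eq: "set B = set (butlast B) \<union> {last B}"
      using ne by (metis append_butlast_last_id list.simps(15) set_append empty_set)
    have "strict_prefix (butlast B) B"
      using ne by (metis append_butlast_last_id strict_prefixI')
    then have "load p (set (butlast B)) \<le> \<theta>" using cut.hyps(3) by auto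
    moreover have "load p {last B} \<le> c"
      using cut.prems(2) ne by (simp add: load_singleton)
    ultimately show ?thesis
      using load_Un_le[OF assms(4), of "set (butlast B)" "{last B}"] True eq by simp
  next
    case False
    then show ?thesis using cut by auto
  qed
qed

text \<open>The cutting loop terminates: with \<open>\<theta> \<ge> 0\<close> each removed prefix is
  nonempty, so the list gets strictly shorter.\<close>

lemma ex_cut_blocks:
  assumes "\<theta> \<ge> 0"
  shows "\<exists>Bs Q. cut_blocks p \<theta> R Bs Q"
proof (induction R rule: length_induct)
  case (1 R)
  show ?case
  proof (cases "load p (set R) > \<theta>")
    case False
    then show ?thesis using cut_blocks.finish by blast
  next
    case True
    let ?P = "\<lambda>k. load p (set (take k R)) > \<theta>"
    define k where "k = (LEAST k. ?P k)"
    have P: "?P k" unfolding k_def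
      by (rule LeastI[of ?P "length R"]) (use True in simp)
    have small: "\<not> ?P k'" if "k' < k" for k'
      using not_less_Least that unfolding k_def by blast
    have "k \<noteq> 0"
    proof
      assume "k = 0"
      with P assms show False by (simp add: load_def)
    qed
    moreover have "R \<noteq> []" using True assms by (auto simp: load_def)
    ultimately have "length (drop k R) < length R" by simp
    with 1 obtain Bs Q where "cut_blocks p \<theta> (drop k R) Bs Q" by blast
    \<comment> \<open>A strict prefix of \<open>take k R\<close> is itself \<open>take k' R\<close>
      for some \<open>k' < k\<close>, so leastness of \<open>k\<close> applies.\<close>
    moreover have "\<not> load p (set B') > \<theta>" if B': "strict_prefix B' (take k R)" for B'
    proof -
      have "length B' < k"
        using prefix_length_less[OF B'] by simp
      moreover have "B' = take (length B') R"
      proof -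
        obtain zs where "take k R = B' @ zs"
          using B' by (elim strict_prefixE prefixE)
        then show ?thesis
          using \<open>length B' < k\<close> by (metis append_eq_conv_conj min.absorb3 take_take)
      qed
      ultimately show ?thesis using small by metis
    qed
    ultimately have "cut_blocks p \<theta> (take k R @ drop k R) (take k R # Bs) Q"
      using P True by (intro cut_blocks.cut) auto
    then show ?thesis by auto
  qed
qed

section \<open>The first-crossing assignment\<close>

declare crossing.simps(2) [simp del]

text \<open>This case rule replaces the recursion equation and its \<open>LEAST\<close> from here
  on. The outcomes are: no block left, all remaining blocks fit, or block \<open>l\<close> is the
  first to cross the budget.\<close>

lemma crossing_Suc_cases:
  fixes p :: "real ^ 'n::finite"
  obtains
    "crossing p y N B i > N" "crossing p y N B (Suc i) = crossing p y N B i"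
  | "crossing p y N B i \<le> N" "crossing p y N B (Suc i) = N + 1"
    "(\<Sum>s=crossing p y N B i..N. load p (B s)) \<le> y (Suc i)"
  | l where "crossing p y N B i \<le> l" "l \<le> N" "crossing p y N B (Suc i) = l + 1"
    "(\<Sum>s=crossing p y N B i..l. load p (B s)) > y (Suc i)"
    "\<And>k. crossing p y N B i \<le> k \<Longrightarrow> k < l \<Longrightarrow>
      (\<Sum>s=crossing p y N B i..k. load p (B s)) \<le> y (Suc i)"
proof -
  let ?t = "crossing p y N B i"
  let ?P = "\<lambda>l. l \<ge> ?t \<and> (\<Sum>s=?t..l. load p (B s)) > y (Suc i)"
  consider "?t > N" | "?t \<le> N" "(\<Sum>s=?t..N. load p (B s)) \<le> y (Suc i)"
    | "?t \<le> N" "(\<Sum>s=?t..N. load p (B s)) > y (Suc i)"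
    by linarith
  then show ?thesis
  proof cases
    case 1
    then show ?thesis by (intro that(1)) (simp_all add: crossing.simps(2))
  next
    case 2
    then show ?thesis by (intro that(2)) (simp_all add: crossing.simps(2))
  next
    case 3
    \<comment> \<open>The index \<open>N\<close> witnesses the \<open>LEAST\<close>, which also
      gives \<open>l \<le> N\<close>.\<close>
    then have PN: "?P N" by simp
    define l where "l = (LEAST l. ?P l)"
    have l: "?P l" "l \<le> N"
      unfolding l_def using LeastI[of ?P, OF PN] Least_le[of ?P, OF PN] by blast+
    have before: "(\<Sum>s=?t..k. load p (B s)) \<le> y (Suc i)" if "?t \<le> k" "k < l" for k
      using not_less_Least[of k ?P] that unfolding l_def by (meson not_le)
    have "crossing p y N B (Suc i) = l + 1"
      using 3 by (simp add: crossing.simps(2) Let_def l_def)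
    then show ?thesis using that(3)[of l] l before by blast
  qed
qed

lemma crossing_le_Suc: "crossing p y N B i \<le> crossing p y N B (Suc i)"
  by (rule crossing_Suc_cases[where p = p and y = y and N = N and B = B and i = i]) auto

lemma mono_crossing: "mono (crossing p y N B)"
  using crossing_le_Suc by (auto simp: mono_iff_le_Suc)

lemma crossing_ge_1: "crossing p y N B i \<ge> 1"
  using monoD[OF mono_crossing, of 0 i p y N B] by simp

lemma crossing_le: "crossing p y N B i \<le> N + 1"
proof (induction i)
  case (Suc i)
  then show ?case by (cases rule:
      crossing_Suc_cases[where p = p and y = y and N = N and B = B and i = i]) auto
qed simp

lemma crossing_intervals_disjoint:
  assumes "s \<in> {crossing p y N B (i - 1)..<crossing p y N B i}"
    "s \<in> {crossing p y N B (j - 1)..<crossing p y N B j}"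
  shows "i = j"
proof -
  have "\<not> i < j" if "s < crossing p y N B i" "crossing p y N B (j - 1) \<le> s" for i j
    using that monoD[OF mono_crossing, of i "j - 1" p y N B] by fastforce
  then show ?thesis using assms by (meson atLeastLessThan_iff linorder_neqE_nat)
qed

lemma crossing_intervals_cover:
  "s \<in> {1..<crossing p y N B m} \<Longrightarrow>
    \<exists>i\<in>{1..m}. s \<in> {crossing p y N B (i - 1)..<crossing p y N B i}"
proof (induction m)
  case (Suc m)
  show ?case
  proof (cases "s < crossing p y N B m")
    case True
    then show ?thesis using Suc by fastforce
  next
    case False
    then show ?thesis using Suc.prems by (intro bexI[of _ "Suc m"]) auto
  qed
qed simp

text \<open>The upper end \<open>crossing p y N B i - 1\<close> drops the last block of machine
  \<open>i\<close>, the only one that can cross the budget. The bound serves twice: for the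
  predicted load and for counting blocks.\<close>

lemma crossing_interval_sum_le:
  fixes p :: "real ^ 'n::finite"
  assumes "\<And>j. p $ j \<ge> 0" "y i \<ge> 0" "i \<ge> 1"
  shows "(\<Sum>s\<in>{crossing p y N B (i - 1)..<crossing p y N B i - 1}. load p (B s)) \<le> y i"
proof -
  obtain k where k: "i = Suc k" using assms(3) by (cases i) auto
  define c where "c = crossing p y N B k"
  define d where "d = crossing p y N B (Suc k)"
  have "(\<Sum>s\<in>{c..<d - 1}. load p (B s)) \<le> y (Suc k)"
  proof (cases rule: crossing_Suc_cases[where p = p and y = y and N = N and B = B and i = k,
        folded c_def d_def])
    case 1
    then show ?thesis using assms(2) by (simp add: k)
  next
    case 2
    have "(\<Sum>s\<in>{c..<d - 1}. load p (B s)) \<le> (\<Sum>s\<in>{c..N}. load p (B s))"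
      using 2(2) by (intro sum_mono2 load_nonneg assms(1)) auto
    then show ?thesis using 2(3) by linarith
  next
    case (3 l)
    show ?thesis
    proof (cases "c = l")
      case True
      \<comment> \<open>The first block already crosses, so the sum is empty and
        \<open>y i \<ge> 0\<close> suffices.\<close>
      then show ?thesis using 3(3) assms(2) by (simp add: k)
    next
      case False
      \<comment> \<open>Leastness of \<open>l\<close> is applied at its predecessor
        \<open>l - 1\<close>.\<close>
      then have "(\<Sum>s=c..l - 1. load p (B s)) \<le> y (Suc k)"
        using 3(1) by (intro 3(5)) auto
      moreover have "{c..l - 1} = {c..<l}"
        using False 3(1) by auto
      ultimately show ?thesis using 3(3) by simp
    qed
  qed
  then show ?thesis by (simp add: k c_def d_def)
qed

text \<open>A machine that does not exhaust the blocks receives more than its budget \<open>y i\<close>, so the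
  blocks can only be left over if their total exceeds the total budget.\<close>

lemma crossing_total_gt:
  fixes p :: "real ^ 'n::finite"
  assumes "crossing p y N B m \<le> N" "m \<ge> 1"
  shows "(\<Sum>s\<in>{1..<crossing p y N B m}. load p (B s)) > (\<Sum>i=1..m. y i)"
proof -
  have gain: "(\<Sum>s\<in>{1..<crossing p y N B (Suc m)}. load p (B s)) >
      (\<Sum>s\<in>{1..<crossing p y N B m}. load p (B s)) + y (Suc m)"
    if le: "crossing p y N B (Suc m) \<le> N" for m
  proof (cases rule: crossing_Suc_cases[where p = p and y = y and N = N and B = B and i = m])
    case 1
    then show ?thesis using le by linarith
  next
    case 2
    then show ?thesis using le by linarith
  next
    case (3 l)
    have "{1..<crossing p y N B (Suc m)} = {1..<crossing p y N B m} \<union> {crossing p y N B m..l}"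
      using 3(1,3) crossing_ge_1[of p y N B m] by auto
    then have "(\<Sum>s\<in>{1..<crossing p y N B (Suc m)}. load p (B s)) =
        (\<Sum>s\<in>{1..<crossing p y N B m}. load p (B s)) + (\<Sum>s=crossing p y N B m..l. load p (B s))"
      by (simp only:, intro sum.union_disjoint) auto
    then show ?thesis using 3(4) by linarith
  qed
  \<comment> \<open>The induction starts at one machine: with none, both sums are 0 and the strict
    inequality fails.\<close>
  show ?thesis
    using assms(2,1)
  proof (induction m rule: dec_induct)
    case base
    then show ?case using gain[of 0] by simp
  next
    case (step m)
    then show ?case
      using gain[of m] crossing_le_Suc[of p y N B m] by simp
  qed
qed

section \<open>A fixed run of the algorithm\<close>

text \<open>One resolution of all choices left open by \<open>block_packing\<close>. Its
  \<open>let\<close>-bound quantities are parameters with defining equations, so that an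
  interpretation can supply the unfolded terms.\<close>

locale block_packing_run =
  fixes lam :: real and m N :: nat and U :: "(real ^ 'n::finite) set" and phat :: "real ^ 'n"
    and Sh T :: "nat \<Rightarrow> 'n set" and R :: "nat \<Rightarrow> 'n list" and Bs :: "nat \<Rightarrow> 'n list list"
    and Q :: "nat \<Rightarrow> 'n list" and \<sigma> :: "nat \<Rightarrow> nat" and B :: "nat \<Rightarrow> 'n set"
    and Hh tiny y t L
  defines "Hh \<equiv> {j. phat $ j > opt m phat / lam}"
    and "tiny \<equiv> {i\<in>{1..m}. Q i \<noteq> []}"
    and "y \<equiv> \<lambda>i. load phat (Sh i - Hh)"
    and "t \<equiv> crossing phat y N B"
    and "L \<equiv> \<lambda>i. (\<Union>k\<in>{k\<in>tiny. \<sigma> k = i}. set (Q k)) \<union> (\<Union>s\<in>{t (i - 1)..<t i}. B s)"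
  assumes lam: "lam > 0" and m: "m \<ge> 1" and U: "bounded U" "\<And>p j. p \<in> U \<Longrightarrow> p $ j \<ge> 0"
    and phat: "phat \<in> U"
    and Sh: "is_arg_min (\<lambda>S. cmax m S phat) (\<lambda>S. S \<in> schedules m) Sh"
    and T: "is_arg_min (\<lambda>S. robust_cmax m S U) (\<lambda>S. S \<in> schedules m) T"
    and R: "\<And>i. i \<in> {1..m} \<Longrightarrow> distinct (R i)" "\<And>i. i \<in> {1..m} \<Longrightarrow> set (R i) = T i - Hh"
    and cut: "\<And>i. i \<in> {1..m} \<Longrightarrow> cut_blocks phat (opt m phat / (2 * lam)) (R i) (Bs i) (Q i)"
    and \<sigma>: "inj_on \<sigma> tiny" "\<sigma> ` tiny \<subseteq> {1..m}"
    and B: "bij_betw B {1..N} (\<Union>i\<in>{1..m}. set ` set (Bs i))"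
begin

lemma phat_nonneg: "phat $ j \<ge> 0"
  using U(2)[OF phat] .

lemma Sh_schedule: "Sh \<in> schedules m"
  and opt_eq: "opt m phat = cmax m Sh phat"
  and T_schedule: "T \<in> schedules m"
  and opt_rob_eq: "opt_rob m U = robust_cmax m T U"
  using is_arg_min_schedules_eq_Min[OF Sh] is_arg_min_schedules_eq_Min[OF T]
  by (auto simp: opt_def opt_rob_def)

lemma load_Sh: "i \<in> {1..m} \<Longrightarrow> load phat (Sh i) \<le> opt m phat"
  unfolding opt_eq by (rule load_le_cmax)

lemma opt_nonneg: "opt m phat \<ge> 0"
  using load_Sh[of 1] load_nonneg[OF phat_nonneg, of "Sh 1"] m by simp

text \<open>Serves the degenerate case \<open>opt m phat = 0\<close>, where it forces all predicted
  sizes to vanish.\<close>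

lemma phat_le_opt: "phat $ j \<le> opt m phat"
proof -
  obtain i where i: "i \<in> {1..m}" "j \<in> Sh i"
    using schedules_cover[OF Sh_schedule] by blast
  then have "load phat {j} \<le> load phat (Sh i)" by (intro load_mono phat_nonneg) auto
  then show ?thesis using load_Sh[OF i(1)] by (simp add: load_singleton)
qed

lemma threshold_nonneg: "opt m phat / (2 * lam) \<ge> 0"
  using opt_nonneg lam by simp

lemma load_T: "i \<in> {1..m} \<Longrightarrow> p \<in> U \<Longrightarrow> load p (T i) \<le> opt_rob m U"
  unfolding opt_rob_eq
  using load_le_cmax cmax_le_robust_cmax[OF U _ m] by (meson order_trans)

lemma load_subset_T:
  "i \<in> {1..m} \<Longrightarrow> p \<in> U \<Longrightarrow> A \<subseteq> T i \<Longrightarrow> load p A \<le> opt_rob m U"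
  using load_T load_mono[OF U(2), of p A "T i"] by (meson order_trans)

lemma opt_rob_nonneg: "opt_rob m U \<ge> 0"
  using load_T[of 1] load_nonneg[OF phat_nonneg, of "T 1"] m phat by force

lemma job_le_opt_rob: "p \<in> U \<Longrightarrow> p $ j \<le> opt_rob m U"
proof -
  assume p: "p \<in> U"
  obtain i where "i \<in> {1..m}" "j \<in> T i"
    using schedules_cover[OF T_schedule] by blast
  then show ?thesis using load_subset_T[of i p "{j}"] p by (simp add: load_singleton)
qed

lemma set_R: "i \<in> {1..m} \<Longrightarrow> set (concat (Bs i)) \<union> set (Q i) = T i - Hh"
  using cut_blocks_concat[OF cut, of i] R(2)[of i] by (metis set_append)

lemma distinct_R: "i \<in> {1..m} \<Longrightarrow> distinct (concat (Bs i) @ Q i)"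
  using cut_blocks_concat[OF cut, of i] R(1)[of i] by simp

lemma B_cases:
  assumes "s \<in> {1..N}"
  obtains i A where "i \<in> {1..m}" "A \<in> set (Bs i)" "B s = set A"
  using assms B unfolding bij_betw_def by blast

lemma B_gt: "s \<in> {1..N} \<Longrightarrow> load phat (B s) > opt m phat / (2 * lam)"
  by (erule B_cases) (use cut_blocks_gt[OF cut] in auto)

lemma B_le: "s \<in> {1..N} \<Longrightarrow> load phat (B s) \<le> opt m phat / (2 * lam) + opt m phat / lam"
proof (erule B_cases)
  fix i A assume *: "i \<in> {1..m}" "A \<in> set (Bs i)" "B s = set A"
  show ?thesis unfolding *(3)
    \<comment> \<open>The jobs of \<open>R i\<close> lie outside \<open>Hh\<close>, so
      \<open>c\<close> can be taken as \<open>opt m phat / lam\<close>.\<close>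
    by (rule cut_blocks_le[OF cut[OF *(1)] *(2) threshold_nonneg phat_nonneg])
      (simp add: R(2)[OF *(1)] Hh_def not_less)
qed

lemma B_subset:
  assumes "s \<in> {1..N}"
  obtains i where "i \<in> {1..m}" "B s \<subseteq> T i - Hh"
  using assms
proof (rule B_cases)
  fix i A assume *: "i \<in> {1..m}" "A \<in> set (Bs i)" "B s = set A"
  then have "B s \<subseteq> T i - Hh" using set_R[of i] by auto
  with * that show ?thesis by blast
qed

lemma T_unique: "i \<in> {1..m} \<Longrightarrow> k \<in> {1..m} \<Longrightarrow> x \<in> T i \<Longrightarrow> x \<in> T k \<Longrightarrow> i = k"
  by (rule schedules_unique[OF T_schedule])

text \<open>A shared job determines its part \<open>T i\<close>, then its list in
  \<open>Bs i\<close> because the cut list is distinct. Injectivity of \<open>B\<close> then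
  identifies the two indices.\<close>

lemma B_unique:
  assumes "s \<in> {1..N}" "s' \<in> {1..N}" "x \<in> B s" "x \<in> B s'"
  shows "s = s'"
  using assms(1)
proof (rule B_cases)
  fix i A assume iA: "i \<in> {1..m}" "A \<in> set (Bs i)" "B s = set A"
  show ?thesis using assms(2)
  proof (rule B_cases)
    fix i' A' assume iA': "i' \<in> {1..m}" "A' \<in> set (Bs i')" "B s' = set A'"
    have "i = i'"
      by (rule T_unique[of _ _ x]) (use iA iA' assms set_R[of i] set_R[of i'] in auto)
    have "distinct (concat (Bs i))" using distinct_R[OF iA(1)] by simp
    then have "set A \<inter> set A' = {}" if "A \<noteq> A'"
      using that iA iA' \<open>i = i'\<close> by (simp add: distinct_concat_iff)
    moreover have "x \<in> set A" "x \<in> set A'" using iA(3) iA'(3) assms(3,4) by auto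
    ultimately have "A = A'" by blast
    then have "B s = B s'" using iA iA' by simp
    then show "s = s'" using bij_betw_imp_inj_on[OF B] assms(1,2) by (meson inj_onD)
  qed
qed

lemma B_disjoint_Q:
  assumes "s \<in> {1..N}" "k \<in> {1..m}" "x \<in> B s" "x \<in> set (Q k)"
  shows False
  using assms(1)
proof (rule B_cases)
  fix i A assume iA: "i \<in> {1..m}" "A \<in> set (Bs i)" "B s = set A"
  have "i = k"
    by (rule T_unique[of _ _ x]) (use iA assms set_R[of i] set_R[of k] in auto)
  then show False using distinct_R[OF iA(1)] iA assms by auto
qed

lemma y_nonneg: "y i \<ge> 0"
  unfolding y_def by (rule load_nonneg[OF phat_nonneg])

section \<open>The output is a schedule\<close>

text \<open>If blocks were left over, the assigned ones would have total predicted load above the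
  sum of all budgets. But they are disjoint sets of light jobs, and the budgets cover the load of
  all light jobs.\<close>

lemma crossing_finishes: "t m = N + 1"
proof (rule ccontr)
  assume "t m \<noteq> N + 1"
  then have *: "t m \<le> N" using crossing_le[of phat y N B m] by (simp add: t_def)
  have sub: "s \<in> {1..N}" if "s \<in> {1..<t m}" for s using that * by auto
  have "(\<Sum>i=1..m. y i) < (\<Sum>s\<in>{1..<t m}. load phat (B s))"
    using crossing_total_gt[OF _ m] * unfolding t_def by blast
  also have "\<dots> = load phat (\<Union>s\<in>{1..<t m}. B s)"
    using B_unique sub by (intro load_UN_disjoint[symmetric]) (auto simp: disjoint_family_on_def)
  also have "\<dots> \<le> load phat (- Hh)"
    by (intro load_mono phat_nonneg) (use sub B_subset in blast)
  also have "- Hh = (\<Union>i\<in>{1..m}. Sh i - Hh)"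
    using schedules_cover[OF Sh_schedule] by blast
  also have "load phat \<dots> \<le> (\<Sum>i=1..m. y i)"
    unfolding y_def by (intro load_UN_le phat_nonneg) auto
  finally show False by simp
qed

lemma interval_subset: "i \<in> {1..m} \<Longrightarrow> {t (i - 1)..<t i} \<subseteq> {1..N}"
  using crossing_ge_1[of phat y N B "i - 1"] crossing_le[of phat y N B i] by (auto simp: t_def)

lemma L_light:
  assumes "i \<in> {1..m}" "x \<in> L i"
  shows "x \<notin> Hh"
proof (cases "\<exists>k\<in>tiny. x \<in> set (Q k)")
  case True
  then show ?thesis using set_R by (auto simp: tiny_def)
next
  case False
  then obtain s where s: "s \<in> {t (i - 1)..<t i}" "x \<in> B s" using assms by (auto simp: L_def)
  have "s \<in> {1..N}" using s interval_subset assms(1) by blast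
  then show ?thesis by (rule B_subset) (use s in blast)
qed

text \<open>A light job lies in a single piece. A remainder \<open>Q k\<close> goes only to machine
  \<open>\<sigma> k\<close>, and a block only to the machine whose index interval contains
  it.\<close>

lemma L_unique:
  assumes "i \<in> {1..m}" "i' \<in> {1..m}" "x \<in> L i" "x \<in> L i'"
  shows "i = i'"
proof -
  have cases: "(\<exists>k\<in>tiny. k \<in> {1..m} \<and> \<sigma> k = i \<and> x \<in> set (Q k)) \<or>
      (\<exists>s\<in>{t (i - 1)..<t i}. s \<in> {1..N} \<and> x \<in> B s)"
    if "i \<in> {1..m}" "x \<in> L i" for i
    using that interval_subset[OF that(1)] unfolding L_def tiny_def by blast
  have tiny_unique: "k = k'" if "k \<in> {1..m}" "k' \<in> {1..m}" "x \<in> set (Q k)" "x \<in> set (Q k')" for k k'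
    by (rule T_unique[of _ _ x]) (use that set_R[of k] set_R[of k'] in auto)
  from cases[OF assms(1,3)] show ?thesis
  proof (elim disjE bexE conjE)
    fix k assume k: "k \<in> {1..m}" "\<sigma> k = i" "x \<in> set (Q k)"
    from cases[OF assms(2,4)] show ?thesis
      using k tiny_unique[OF k(1) _ k(3)] B_disjoint_Q[OF _ k(1) _ k(3)] by blast
  next
    fix s assume s: "s \<in> {t (i - 1)..<t i}" "s \<in> {1..N}" "x \<in> B s"
    from cases[OF assms(2,4)] show ?thesis
      using s B_disjoint_Q[OF s(2) _ s(3)] B_unique[OF s(2) _ s(3)]
        crossing_intervals_disjoint[of s phat y N B i i'] unfolding t_def by blast
  qed
qed

lemma L_cover:
  assumes "x \<notin> Hh"
  shows "\<exists>i\<in>{1..m}. x \<in> L i"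
proof -
  obtain k where k: "k \<in> {1..m}" "x \<in> T k" using schedules_cover[OF T_schedule] by blast
  then consider A where "A \<in> set (Bs k)" "x \<in> set A" | "x \<in> set (Q k)"
    using assms set_R[OF k(1)] by auto
  then show ?thesis
  proof cases
    case 1
    then have "set A \<in> B ` {1..N}" using k B unfolding bij_betw_def by blast
    then obtain s where s: "s \<in> {1..N}" "B s = set A" by auto
    \<comment> \<open>No block is lost, because the assignment runs through all \<open>N\<close>
      indices.\<close>
    then have "s \<in> {1..<t m}" using crossing_finishes by simp
    then obtain i where "i \<in> {1..m}" "s \<in> {t (i - 1)..<t i}"
      using crossing_intervals_cover unfolding t_def by blast
    then show ?thesis using s 1 unfolding L_def by blast
  next
    case 2
    then have "k \<in> tiny" using k by (auto simp: tiny_def)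
    then show ?thesis using \<sigma> 2 unfolding L_def by blast
  qed
qed

text \<open>Heavy jobs are partitioned by \<open>Sh\<close> and light jobs by \<open>L\<close>;
  \<open>L_light\<close> keeps the two kinds apart.\<close>

lemma output_schedule: "(\<lambda>i\<in>{1..m}. Sh i \<inter> Hh \<union> L i) \<in> schedules m"
proof -
  have "i = k"
    if "i \<in> {1..m}" "k \<in> {1..m}" "x \<in> Sh i \<inter> Hh \<union> L i" "x \<in> Sh k \<inter> Hh \<union> L k" for i k x
    using that L_light L_unique schedules_unique[OF Sh_schedule, of i k x] by blast
  then have "disjoint_family_on (\<lambda>i\<in>{1..m}. Sh i \<inter> Hh \<union> L i) {1..m}"
    unfolding disjoint_family_on_def restrict_apply by (simp del: atLeastAtMost_iff) blast
  moreover have "\<exists>i\<in>{1..m}. x \<in> Sh i \<inter> Hh \<union> L i" for x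
    using schedules_cover[OF Sh_schedule, of x] L_cover[of x] by blast
  then have "(\<Union>i\<in>{1..m}. (\<lambda>i\<in>{1..m}. Sh i \<inter> Hh \<union> L i) i) = UNIV"
    by (simp del: atLeastAtMost_iff) blast
  ultimately show ?thesis
    unfolding schedules_def by blast
qed

section \<open>Consistency and robustness on a single machine\<close>

text \<open>Injectivity of \<open>\<sigma>\<close> leaves at most one remainder per machine, so
  bounds on the union reduce to bounds on one \<open>Q k\<close>.\<close>

lemma tiny_part_cases:
  obtains "(\<Union>k\<in>{k\<in>tiny. \<sigma> k = i}. set (Q k)) = {}"
  | k where "k \<in> {1..m}" "(\<Union>k\<in>{k\<in>tiny. \<sigma> k = i}. set (Q k)) = set (Q k)"
proof (cases "\<exists>k\<in>tiny. \<sigma> k = i")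
  case True
  then obtain k where "k \<in> tiny" "\<sigma> k = i" by auto
  then have "{k\<in>tiny. \<sigma> k = i} = {k}" using \<sigma>(1) by (auto simp: inj_on_def)
  then show ?thesis using that(2)[of k] \<open>k \<in> tiny\<close> by (auto simp: tiny_def)
qed (use that in auto)

lemma tiny_part_le_threshold:
  "load phat (\<Union>k\<in>{k\<in>tiny. \<sigma> k = i}. set (Q k)) \<le> opt m phat / (2 * lam)"
proof (cases rule: tiny_part_cases[of i])
  case 1
  show ?thesis using threshold_nonneg unfolding 1 by (simp add: load_def)
next
  case (2 k)
  show ?thesis using cut_blocks_remainder[OF cut[OF 2(1)]] unfolding 2(2) .
qed

lemma tiny_part_le_opt_rob:
  assumes "p \<in> U"
  shows "load p (\<Union>k\<in>{k\<in>tiny. \<sigma> k = i}. set (Q k)) \<le> opt_rob m U"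
proof (cases rule: tiny_part_cases[of i])
  case 1
  show ?thesis using opt_rob_nonneg unfolding 1 by (simp add: load_def)
next
  case (2 k)
  show ?thesis using load_subset_T[OF 2(1) assms] set_R[OF 2(1)] unfolding 2(2) by auto
qed

lemma interval_sum_le:
  "i \<in> {1..m} \<Longrightarrow> (\<Sum>s\<in>{t (i - 1)..<t i - 1}. load phat (B s)) \<le> y i"
  unfolding t_def by (intro crossing_interval_sum_le phat_nonneg y_nonneg) auto

lemma load_Sh_split: "load phat (Sh i) = load phat (Sh i \<inter> Hh) + y i"
  unfolding load_def y_def by (simp add: sum.Int_Diff)

lemma consistency:
  assumes i: "i \<in> {1..m}"
  shows "load phat (Sh i \<inter> Hh \<union> L i) \<le> (1 + 2 / lam) * opt m phat"
proof -
  let ?\<theta> = "opt m phat / (2 * lam)"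
  have "load phat (\<Union>s\<in>{t (i - 1)..<t i}. B s) \<le> (\<Sum>s\<in>{t (i - 1)..<t i}. load phat (B s))"
    by (intro load_UN_le phat_nonneg) auto
  also have "\<dots> \<le> y i + (?\<theta> + opt m phat / lam)"
  proof (cases "t (i - 1) < t i")
    case True
    \<comment> \<open>The last block is split off: the earlier ones fit into \<open>y i\<close>, and
      \<open>B_le\<close> bounds the last.\<close>
    then have "{t (i - 1)..<t i} = insert (t i - 1) {t (i - 1)..<t i - 1}" by auto
    moreover have "t i - 1 \<in> {1..N}" using interval_subset[OF i] True by fastforce
    ultimately show ?thesis using interval_sum_le[OF i] B_le[of "t i - 1"] by simp
  next
    case False
    then show ?thesis using y_nonneg[of i] threshold_nonneg opt_nonneg lam by simp
  qed
  finally have "load phat (L i) \<le> ?\<theta> + (y i + (?\<theta> + opt m phat / lam))"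
    unfolding L_def
    using load_Un_le[OF phat_nonneg] tiny_part_le_threshold[of i] by (smt (verit))
  then have "load phat (Sh i \<inter> Hh \<union> L i)
      \<le> load phat (Sh i \<inter> Hh) + (?\<theta> + (y i + (?\<theta> + opt m phat / lam)))"
    using load_Un_le[OF phat_nonneg, of "Sh i \<inter> Hh" "L i"] by linarith
  \<comment> \<open>The budget \<open>y i\<close> is the predicted light load of
    \<open>Sh i\<close>, so it recombines with the heavy part.\<close>
  also have "\<dots> = load phat (Sh i) + (?\<theta> + ?\<theta> + opt m phat / lam)"
    by (simp add: load_Sh_split)
  also have "\<dots> \<le> opt m phat + (?\<theta> + ?\<theta> + opt m phat / lam)"
    using load_Sh[OF i] by simp
  also have "\<dots> = (1 + 2 / lam) * opt m phat"
    using lam by (simp add: field_simps)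
  finally show ?thesis .
qed

lemma count_pieces:
  assumes i: "i \<in> {1..m}"
  shows "real (card (Sh i \<inter> Hh)) + real (t i - t (i - 1)) \<le> 2 * lam + 1"
\<comment> \<open>For optimum 0 the threshold is 0 and cannot be cancelled. Then no job is heavy,
  and no block exists since its load would have to be positive.\<close>
proof (cases "opt m phat = 0")
  case True
  then have zero: "phat $ j = 0" for j
    using phat_le_opt[of j] phat_nonneg[of j] by simp
  then have "Hh = {}" using True by (simp add: Hh_def)
  moreover have "{t (i - 1)..<t i} = {}"
  proof (rule equals0I)
    fix s assume "s \<in> {t (i - 1)..<t i}"
    then have "s \<in> {1..N}" using interval_subset[OF i] by blast
    then show False using B_gt[of s] zero True by (simp add: load_def)
  qed
  ultimately show ?thesis using lam by simp
next
  case False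
  then have pos: "opt m phat > 0" using opt_nonneg by simp
  let ?\<theta> = "opt m phat / (2 * lam)"
  \<comment> \<open>A heavy job exceeds \<open>opt m phat / lam\<close>, which is
    \<open>2 * ?\<theta>\<close>.\<close>
  have "real (card (Sh i \<inter> Hh)) * (2 * ?\<theta>) \<le> load phat (Sh i \<inter> Hh)"
    unfolding load_def by (rule sum_bounded_below) (auto simp: Hh_def)
  moreover have "real (card {t (i - 1)..<t i - 1}) * ?\<theta>
      \<le> (\<Sum>s\<in>{t (i - 1)..<t i - 1}. load phat (B s))"
  proof (rule sum_bounded_below)
    fix s assume "s \<in> {t (i - 1)..<t i - 1}"
    then have "s \<in> {1..N}" using interval_subset[OF i] by fastforce
    then show "?\<theta> \<le> load phat (B s)" using B_gt by fastforce
  qed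
  moreover have "opt m phat = 2 * lam * ?\<theta>" using lam by simp
  ultimately have "real (card (Sh i \<inter> Hh)) * (2 * ?\<theta>) + real (t i - 1 - t (i - 1)) * ?\<theta>
      \<le> 2 * lam * ?\<theta>"
    using interval_sum_le[OF i] load_Sh[OF i] load_Sh_split[of i] by (smt (verit) card_atLeastLessThan)
  then have "(2 * real (card (Sh i \<inter> Hh)) + real (t i - 1 - t (i - 1))) * ?\<theta> \<le> (2 * lam) * ?\<theta>"
    by (simp add: algebra_simps)
  moreover have "?\<theta> > 0" using pos lam by simp
  ultimately have "2 * real (card (Sh i \<inter> Hh)) + real (t i - 1 - t (i - 1)) \<le> 2 * lam"
    by (rule mult_right_le_imp_le)
  \<comment> \<open>One factor 2 on the heavy count is given away, and the \<open>+ 1\<close>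
    restores the last block. With truncated subtraction this also holds for an empty
    interval.\<close>
  then show ?thesis by linarith
qed

lemma robustness:
  assumes i: "i \<in> {1..m}" and p: "p \<in> U"
  shows "load p (Sh i \<inter> Hh \<union> L i) \<le> (2 * lam + 4) * opt_rob m U"
proof -
  note nonneg = U(2)[OF p]
  let ?r = "opt_rob m U"
  have heavy: "load p (Sh i \<inter> Hh) \<le> real (card (Sh i \<inter> Hh)) * ?r"
    unfolding load_def by (rule sum_bounded_above) (rule job_le_opt_rob[OF p])
  have "load p (\<Union>s\<in>{t (i - 1)..<t i}. B s) \<le> (\<Sum>s\<in>{t (i - 1)..<t i}. load p (B s))"
    by (intro load_UN_le nonneg) auto
  also have "\<dots> \<le> real (card {t (i - 1)..<t i}) * ?r"
  proof (rule sum_bounded_above)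
    fix s assume "s \<in> {t (i - 1)..<t i}"
    then have "s \<in> {1..N}" using interval_subset[OF i] by blast
    then show "load p (B s) \<le> ?r" by (rule B_subset) (auto intro: load_subset_T p)
  qed
  finally have "load p (L i) \<le> ?r + real (t i - t (i - 1)) * ?r"
    unfolding L_def
    using load_Un_le[OF nonneg] tiny_part_le_opt_rob[OF p, of i]
    by (smt (verit) card_atLeastLessThan)
  then have "load p (Sh i \<inter> Hh \<union> L i)
      \<le> (real (card (Sh i \<inter> Hh)) + real (t i - t (i - 1)) + 1) * ?r"
    using load_Un_le[OF nonneg, of "Sh i \<inter> Hh" "L i"] heavy by (simp add: algebra_simps)
  \<comment> \<open>The \<open>+ 1\<close> counts the tiny block. The coefficient is in fact at most
    \<open>2 * lam + 2\<close>.\<close>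
  also have "\<dots> \<le> (2 * lam + 4) * ?r"
    using count_pieces[OF i] opt_rob_nonneg by (intro mult_right_mono) auto
  finally show ?thesis .
qed

end

section \<open>Existence of a run and the final guarantee\<close>

text \<open>Ensures that a guarantee for every output of the algorithm is not vacuous.\<close>

lemma ex_block_packing:
  fixes U :: "(real ^ 'n::finite) set"
  assumes "lam > 0" "m \<ge> 1" "\<And>j. phat $ j \<ge> 0"
  shows "\<exists>S. block_packing m lam U phat S"
proof -
  obtain Sh where Sh: "is_arg_min (\<lambda>S. cmax m S phat) (\<lambda>S. S \<in> schedules m) Sh"
    using ex_is_arg_min_schedules[OF assms(2)] by blast
  obtain T where T: "is_arg_min (\<lambda>S. robust_cmax m S U) (\<lambda>S. S \<in> schedules m) T"
    using ex_is_arg_min_schedules[OF assms(2)] by blast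
  have "0 \<le> load phat (Sh 1)" by (rule load_nonneg[OF assms(3)])
  also have "\<dots> \<le> cmax m Sh phat" using assms(2) by (intro load_le_cmax) auto
  also have "\<dots> = opt m phat"
    using is_arg_min_schedules_eq_Min(2)[OF Sh] by (simp add: opt_def)
  finally have \<theta>: "opt m phat / (2 * lam) \<ge> 0" using assms(1) by simp
  let ?Hh = "{j. phat $ j > opt m phat / lam}"
  have "\<exists>R. distinct R \<and> set R = T i - ?Hh" for i
    using finite_distinct_list[of "T i - ?Hh"] by auto
  then obtain R where R: "\<And>i. distinct (R i) \<and> set (R i) = T i - ?Hh" by metis
  have "\<exists>Bs Q. cut_blocks phat (opt m phat / (2 * lam)) (R i) Bs Q" for i
    by (rule ex_cut_blocks[OF \<theta>])
  then obtain Bs Q where cut: "\<And>i. cut_blocks phat (opt m phat / (2 * lam)) (R i) (Bs i) (Q i)"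
    by metis
  have "finite (\<Union>i\<in>{1..m}. set ` set (Bs i))" by simp
  then obtain B where
    B: "bij_betw B {1..card (\<Union>i\<in>{1..m}. set ` set (Bs i))} (\<Union>i\<in>{1..m}. set ` set (Bs i))"
    using ex_bij_betw_nat_finite_1 by blast
  show ?thesis
    unfolding block_packing_def Let_def
    \<comment> \<open>The identity serves as \<open>\<sigma>\<close>: the tiny block of part
      \<open>i\<close>, if any, stays on machine \<open>i\<close>. The output and \<open>N\<close>
      are left to unification.\<close>
    by (rule exI, rule exI[of _ Sh], rule exI[of _ T], rule exI[of _ R], rule exI[of _ Bs],
        rule exI[of _ Q], rule exI[of _ id], rule exI, rule exI[of _ B])
      (use Sh T R cut B in auto)
qed

theorem theorem11:
  fixes lam :: real and m :: nat and U :: "(real ^ 'n::finite) set" and phat :: "real ^ 'n"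
  assumes "lam > 0"
    and "m \<ge> 1"
    and "U \<noteq> {}"
    and "bounded U"
    and "\<forall>p\<in>U. \<forall>j. p $ j \<ge> 0"
    and "phat \<in> U"
  shows "(\<exists>S. block_packing m lam U phat S) \<and>
    (\<forall>S. block_packing m lam U phat S \<longrightarrow>
      S \<in> schedules m \<and>
      cmax m S phat \<le> (1 + 2 / lam) * opt m phat \<and>
      robust_cmax m S U \<le> (2 * lam + 4) * opt_rob m U)"
proof (intro conjI[OF ex_block_packing] allI impI)
  show "lam > 0" "m \<ge> 1" "\<And>j. phat $ j \<ge> 0" using assms by auto
next
  fix S assume S: "block_packing m lam U phat S"
  let ?Hh = "{j. phat $ j > opt m phat / lam}"
  obtain Sh T R Bs Q \<sigma> N B where
    "is_arg_min (\<lambda>S. cmax m S phat) (\<lambda>S. S \<in> schedules m) Sh"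
    "is_arg_min (\<lambda>S. robust_cmax m S U) (\<lambda>S. S \<in> schedules m) T"
    "\<forall>i\<in>{1..m}. distinct (R i) \<and> set (R i) = T i - ?Hh \<and>
       cut_blocks phat (opt m phat / (2 * lam)) (R i) (Bs i) (Q i)"
    "inj_on \<sigma> {i\<in>{1..m}. Q i \<noteq> []}" "\<sigma> ` {i\<in>{1..m}. Q i \<noteq> []} \<subseteq> {1..m}"
    "bij_betw B {1..N} (\<Union>i\<in>{1..m}. set ` set (Bs i))"
    and S_eq: "S = (\<lambda>i\<in>{1..m}. (Sh i \<inter> ?Hh) \<union>
      ((\<Union>k\<in>{k\<in>{i\<in>{1..m}. Q i \<noteq> []}. \<sigma> k = i}. set (Q k)) \<union>
       (\<Union>s\<in>{crossing phat (\<lambda>i. load phat (Sh i - ?Hh)) N B (i - 1)..<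
         crossing phat (\<lambda>i. load phat (Sh i - ?Hh)) N B i}. B s)))"
    using S unfolding block_packing_def Let_def by (elim exE conjE) (rule that)
  then interpret run: block_packing_run lam m N U phat Sh T R Bs Q \<sigma> B
      ?Hh "{i\<in>{1..m}. Q i \<noteq> []}" "\<lambda>i. load phat (Sh i - ?Hh)"
      "crossing phat (\<lambda>i. load phat (Sh i - ?Hh)) N B"
      "\<lambda>i. (\<Union>k\<in>{k\<in>{i\<in>{1..m}. Q i \<noteq> []}. \<sigma> k = i}. set (Q k)) \<union>
       (\<Union>s\<in>{crossing phat (\<lambda>i. load phat (Sh i - ?Hh)) N B (i - 1)..<
         crossing phat (\<lambda>i. load phat (Sh i - ?Hh)) N B i}. B s)"
    using assms by unfold_locales auto
  have "robust_cmax m S U \<le> (2 * lam + 4) * opt_rob m U"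
    unfolding robust_cmax_def
  \<comment> \<open>The supremum is bounded scenario by scenario, which requires \<open>U\<close> to
    be nonempty, and then machine by machine.\<close>
  proof (intro cSUP_least \<open>U \<noteq> {}\<close> cmax_leI \<open>m \<ge> 1\<close>)
    fix p i assume "p \<in> U" "i \<in> {1..m}"
    then show "load p (S i) \<le> (2 * lam + 4) * opt_rob m U"
      unfolding S_eq restrict_apply by (simp only: if_True run.robustness)
  qed
  moreover have "cmax m S phat \<le> (1 + 2 / lam) * opt m phat"
  proof (intro cmax_leI \<open>m \<ge> 1\<close>)
    fix i assume "i \<in> {1..m}"
    then show "load phat (S i) \<le> (1 + 2 / lam) * opt m phat"
      unfolding S_eq restrict_apply by (simp only: if_True run.consistency)
  qed
  ultimately show "S \<in> schedules m \<and>
      cmax m S phat \<le> (1 + 2 / lam) * opt m phat \<and>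
      robust_cmax m S U \<le> (2 * lam + 4) * opt_rob m U"
    using run.output_schedule unfolding S_eq by blast
qed

end
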